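(* Let $\theta:\mathbb{R}^n\to(-\infty,\infty]$ be a closed proper convex function and let $F:\mathbb{R}^n\to\mathbb{R}^n$ be monotone and Lipschitz continuous with constant $L>0$, such that the solution set $\Omega^*$ of $\mathrm{MGVI}(\theta,F)$ is nonempty. Let $\nu\in(0,1)$, $x^0\in\mathbb{R}^n$, and let $\{x^k\}_k$ be a sequence generated by the algorithm GEM (defined in the context) with step sizes $\{\beta^k\}_k$. Suppose that $\{\beta^k\}_k$ is bounded and $\inf_k \beta^k>0$. Then $\{x^k\}_k$ converges to a solution of $\mathrm{MGVI}(\theta,F)$.
   Context: $\mathbb{R}^n$ carries the standard inner product and Euclidean norm $\|\cdot\|$. A function is closed proper convex if its epigraph is closed and convex and its effective domain $\{x:\theta(x)<\infty\}$ is nonempty. $F$ is monotone if $(F(x)-F(y))^T(x-y)\ge 0$ for all $x,y\in\mathbb{R}^n$. A solution of $\mathrm{MGVI}(\theta,F)$ is a point $x^*\in\mathbb{R}^n$ with $\theta(x)-\theta(x^* )+(x-x^* )^TF(x^* )\ge 0$ for all $x\in\mathbb{R}^n$ (with the convention $\infty-\infty=\infty$); $\Omega^*$ is the set of solutions. For a closed proper convex $f$, $\mathrm{Prox}_f(x)$ is the unique minimizer over $y\in\mathbb{R}^n$ of $f(y)+\frac12\|x-y\|^2$. Algorithm GEM: given $x^0\in\mathbb{R}^n$ and $\nu\in(0,1)$, for $k=0,1,2,\dots$: (Predictor) select $\beta^k>0$ such that $\beta^k\|F(x^k)-F(\tilde x^k)\|\le \nu\|x^k-\tilde x^k\|$,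 where $\tilde x^k=\mathrm{Prox}_{\beta^k\theta}(x^k-\beta^kF(x^k))$; (Corrector) set $x^{k+1}=\mathrm{Prox}_{\beta^k\theta}(x^k-\beta^kF(\tilde x^k))$. *)

theory Defs
  imports "HOL-Analysis.Analysis"
begin

text \<open>
  Functions with values in \<open>(-\<infinity>, \<infinity>]\<close> are rendered as functions into \<^typ>\<open>ereal\<close> that never take
  the value \<open>-\<infinity>\<close>. The library constant \<^const>\<open>epigraph\<close> is for real-valued functions only.
\<close>

definition ereal_epigraph :: "('a \<Rightarrow> ereal) \<Rightarrow> ('a \<times> real) set" where
  "ereal_epigraph f = {(x, r). f x \<le> ereal r}"

definition effective_domain :: "('a \<Rightarrow> ereal) \<Rightarrow> 'a set" where
  "effective_domain f = {x. f x < \<infinity>}"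

definition closed_proper_convex :: "(real ^ 'n \<Rightarrow> ereal) \<Rightarrow> bool" where
  "closed_proper_convex f \<longleftrightarrow>
     (\<forall>x. f x \<noteq> -\<infinity>) \<and>
     closed (ereal_epigraph f) \<and>
     convex (ereal_epigraph f) \<and>
     effective_domain f \<noteq> {}"

definition monotone_operator :: "(real ^ 'n \<Rightarrow> real ^ 'n) \<Rightarrow> bool" where
  "monotone_operator F \<longleftrightarrow> (\<forall>x y. (F x - F y) \<bullet> (x - y) \<ge> 0)"

text \<open>Subtraction on \<^typ>\<open>ereal\<close> satisfies \<open>\<infinity> - \<infinity> = \<infinity>\<close>, which is the convention wanted here.\<close>

definition mgvi_solutions ::
    "(real ^ 'n \<Rightarrow> ereal) \<Rightarrow> (real ^ 'n \<Rightarrow> real ^ 'n) \<Rightarrow> (real ^ 'n) set" where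
  "mgvi_solutions \<theta> F =
     {xs. \<forall>x. \<theta> x - \<theta> xs + ereal ((x - xs) \<bullet> F xs) \<ge> 0}"

definition prox :: "(real ^ 'n \<Rightarrow> ereal) \<Rightarrow> real ^ 'n \<Rightarrow> real ^ 'n" where
  "prox f x = (THE y. is_arg_min (\<lambda>y. f y + ereal (1 / 2 * (norm (x - y))\<^sup>2)) (\<lambda>_. True) y)"

definition gem_predictor ::
    "(real ^ 'n \<Rightarrow> ereal) \<Rightarrow> (real ^ 'n \<Rightarrow> real ^ 'n) \<Rightarrow> real \<Rightarrow> real ^ 'n \<Rightarrow> real ^ 'n" where
  "gem_predictor \<theta> F b x = prox (\<lambda>y. ereal b * \<theta> y) (x - b *\<^sub>R F x)"

text \<open>The step sizes \<open>\<beta>\<close> are any sequence meeting the acceptance test; no selection rule is fixed.\<close>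

definition gem_sequence ::
    "(real ^ 'n \<Rightarrow> ereal) \<Rightarrow> (real ^ 'n \<Rightarrow> real ^ 'n) \<Rightarrow> real \<Rightarrow> real ^ 'n \<Rightarrow>
     (nat \<Rightarrow> real) \<Rightarrow> (nat \<Rightarrow> real ^ 'n) \<Rightarrow> bool" where
  "gem_sequence \<theta> F \<nu> x0 \<beta> x \<longleftrightarrow>
     x 0 = x0 \<and>
     (\<forall>k. let xt = gem_predictor \<theta> F (\<beta> k) (x k) in
        \<beta> k > 0 \<and>
        \<beta> k * norm (F (x k) - F xt) \<le> \<nu> * norm (x k - xt) \<and>
        x (Suc k) = prox (\<lambda>y. ereal (\<beta> k) * \<theta> y) (x k - \<beta> k *\<^sub>R F xt))"

end

theory Submission
  imports Defs
begin

text \<open>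
  The method is a contraction towards every solution. Optimality of a proximal point
  \<open>p = prox (b \<theta>) x\<close> is the variational inequality
  \<open>(x - p) \<bullet> (y - p) \<le> b (\<theta> y - \<theta> p)\<close>. Writing it for the corrector against a solution \<open>s\<close>, for
  the predictor against the corrector, and adding the inequality that defines \<open>s\<close> (transported
  from \<open>s\<close> to the predictor by monotonicity), all values of \<open>\<theta>\<close> cancel. The acceptance test for
  the step size absorbs the only remaining cross term, which leaves
  \<open>\<parallel>x\<^bsub>k+1\<^esub> - s\<parallel>\<^sup>2 \<le> \<parallel>x\<^bsub>k\<^esub> - s\<parallel>\<^sup>2 - (1 - \<nu>\<^sup>2) \<parallel>x\<^bsub>k\<^esub> - y\<^bsub>k\<^esub>\<parallel>\<^sup>2\<close>, where \<open>y\<^bsub>k\<^esub>\<close> is the predictor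
  (\<open>extragradient_descent\<close>).

  Hence the iterates are bounded and \<open>x\<^bsub>k\<^esub> - y\<^bsub>k\<^esub>\<close> tends to \<open>0\<close>, so the predictors have the same
  cluster points as the iterates. Since the step sizes stay away from \<open>0\<close>, the predictor's
  variational inequality survives the limit, the values of \<open>\<theta>\<close> being controlled by closedness of
  the epigraph, and every cluster point is a solution (\<open>predictor_limit_solves\<close>). The distance to
  that particular solution is then nonincreasing and tends to \<open>0\<close> along a subsequence, hence tends
  to \<open>0\<close> (\<open>Fejer_monotone_convergent\<close>).

  The existence of proximal points, without which \<^const>\<open>prox\<close> would carry no information, comes
  from an affine minorant of \<open>\<theta>\<close>. Any solution \<open>s\<close> provides one, with slope \<open>- F s\<close> and equality
  at \<open>s\<close>.
\<close>

section \<open>Finite values of a closed proper convex function\<close>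

lemma ereal_value_on_domain:
  assumes "closed_proper_convex \<theta>" and "y \<in> effective_domain \<theta>"
  shows "\<theta> y = ereal (real_of_ereal (\<theta> y))"
proof -
  have "\<theta> y \<noteq> -\<infinity>" "\<theta> y \<noteq> \<infinity>"
    using assms unfolding closed_proper_convex_def effective_domain_def by auto
  then show ?thesis by (cases "\<theta> y") auto
qed

lemma in_epigraphD:
  assumes "closed_proper_convex \<theta>" and "\<theta> y \<le> ereal r"
  shows "y \<in> effective_domain \<theta>" and "real_of_ereal (\<theta> y) \<le> r"
proof -
  show d: "y \<in> effective_domain \<theta>"
    using assms(2) unfolding effective_domain_def by (cases "\<theta> y") auto
  show "real_of_ereal (\<theta> y) \<le> r"
    using assms(2) ereal_value_on_domain[OF assms(1) d] by (metis ereal_less_eq(3))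
qed

lemma convex_on_domain:
  assumes cpc: "closed_proper_convex \<theta>"
    and y: "y \<in> effective_domain \<theta>" and z: "z \<in> effective_domain \<theta>"
    and u: "0 \<le> u" "u \<le> 1"
  shows "y + u *\<^sub>R (z - y) \<in> effective_domain \<theta>"
    and "real_of_ereal (\<theta> (y + u *\<^sub>R (z - y)))
           \<le> real_of_ereal (\<theta> y) + u * (real_of_ereal (\<theta> z) - real_of_ereal (\<theta> y))"
proof -
  let ?t = "\<lambda>y. real_of_ereal (\<theta> y)"
  have c: "convex (ereal_epigraph \<theta>)"
    using cpc unfolding closed_proper_convex_def by blast
  have "(y, ?t y) \<in> ereal_epigraph \<theta>" "(z, ?t z) \<in> ereal_epigraph \<theta>"
    using ereal_value_on_domain[OF cpc y] ereal_value_on_domain[OF cpc z]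
    unfolding ereal_epigraph_def by auto
  then have "(1 - u) *\<^sub>R (y, ?t y) + u *\<^sub>R (z, ?t z) \<in> ereal_epigraph \<theta>"
    using u by (intro convexD[OF c]) auto
  moreover have "(1 - u) *\<^sub>R (y, ?t y) + u *\<^sub>R (z, ?t z)
      = (y + u *\<^sub>R (z - y), ?t y + u * (?t z - ?t y))"
    by (simp add: algebra_simps)
  ultimately have "\<theta> (y + u *\<^sub>R (z - y)) \<le> ereal (?t y + u * (?t z - ?t y))"
    unfolding ereal_epigraph_def by simp
  from in_epigraphD[OF cpc this]
  show "y + u *\<^sub>R (z - y) \<in> effective_domain \<theta>"
    and "?t (y + u *\<^sub>R (z - y)) \<le> ?t y + u * (?t z - ?t y)" .
qed

text \<open>
  A solution has a finite value because \<open>r - \<infinity> = -\<infinity>\<close> at any point of the domain; points outside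
  the domain impose no condition.
\<close>

lemma mgvi_solutions_iff:
  assumes cpc: "closed_proper_convex \<theta>"
  shows "s \<in> mgvi_solutions \<theta> F \<longleftrightarrow>
    s \<in> effective_domain \<theta> \<and>
    (\<forall>y \<in> effective_domain \<theta>. real_of_ereal (\<theta> s) \<le> real_of_ereal (\<theta> y) + (y - s) \<bullet> F s)"
    (is "_ \<longleftrightarrow> ?R")
proof
  assume s: "s \<in> mgvi_solutions \<theta> F"
  have ge: "\<theta> y - \<theta> s + ereal ((y - s) \<bullet> F s) \<ge> 0" for y
    using s unfolding mgvi_solutions_def by blast
  obtain w where w: "w \<in> effective_domain \<theta>"
    using cpc unfolding closed_proper_convex_def by blast
  have "s \<in> effective_domain \<theta>"
  proof (rule ccontr)
    assume "s \<notin> effective_domain \<theta>"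
    then have "\<theta> s = \<infinity>" unfolding effective_domain_def by simp
    moreover obtain r where "\<theta> w = ereal r" using ereal_value_on_domain[OF cpc w] by blast
    ultimately show False using ge[of w] by simp
  qed
  moreover have "real_of_ereal (\<theta> s) \<le> real_of_ereal (\<theta> y) + (y - s) \<bullet> F s"
    if y: "y \<in> effective_domain \<theta>" for y
  proof -
    obtain p q where "\<theta> y = ereal p" "\<theta> s = ereal q"
      using ereal_value_on_domain[OF cpc y] ereal_value_on_domain[OF cpc calculation] by blast
    then show ?thesis using ge[of y] by simp
  qed
  ultimately show ?R by blast
next
  assume R: ?R
  then obtain q where q: "\<theta> s = ereal q" using ereal_value_on_domain[OF cpc] by blast
  have "\<theta> y - \<theta> s + ereal ((y - s) \<bullet> F s) \<ge> 0" for y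
  proof (cases "y \<in> effective_domain \<theta>")
    case True
    then obtain p where "\<theta> y = ereal p" using ereal_value_on_domain[OF cpc] by blast
    then show ?thesis using R True q by auto
  next
    case False
    then have "\<theta> y = \<infinity>" unfolding effective_domain_def by simp
    then show ?thesis using q by simp
  qed
  then show "s \<in> mgvi_solutions \<theta> F" unfolding mgvi_solutions_def by blast
qed

section \<open>Proximal points\<close>

text \<open>
  On the epigraph the objective becomes the continuous function \<open>b r + \<parallel>x - y\<parallel>\<^sup>2 / 2\<close> of \<open>(y, r)\<close>.
  The affine minorant makes its sublevel sets bounded, so it attains its infimum over the closed
  epigraph, even though \<open>\<theta>\<close> itself is merely lower semicontinuous.
\<close>

lemma prox_minimizer_exists:
  assumes cpc: "closed_proper_convex \<theta>" and b: "b > 0"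
    and minorant: "\<And>y. y \<in> effective_domain \<theta> \<Longrightarrow> c + y \<bullet> a \<le> real_of_ereal (\<theta> y)"
  shows "\<exists>p. is_arg_min (\<lambda>y. ereal b * \<theta> y + ereal (1 / 2 * (norm (x - y))\<^sup>2)) (\<lambda>_. True) p"
proof -
  let ?t = "\<lambda>y. real_of_ereal (\<theta> y)"
  let ?E = "ereal_epigraph \<theta>"
  define h where "h = (\<lambda>(y, r). b * r + 1 / 2 * (norm (x - y))\<^sup>2)"
  have h_cont: "continuous_on UNIV h"
    unfolding h_def case_prod_beta by (intro continuous_intros)
  obtain w where w: "w \<in> effective_domain \<theta>"
    using cpc unfolding closed_proper_convex_def by blast
  have wE: "(w, ?t w) \<in> ?E"
    using ereal_value_on_domain[OF cpc w] unfolding ereal_epigraph_def by auto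
  define M where "M = h (w, ?t w)"
  define S where "S = ?E \<inter> {q. h q \<le> M}"
  have "closed S"
    unfolding S_def
    using cpc h_cont
    by (intro closed_Int closed_Collect_le) (auto simp: closed_proper_convex_def)
  moreover have "bounded S"
  proof -
    define v where "v = x - b *\<^sub>R a"
    define K where "K = 2 * (M - b * c) + (norm v)\<^sup>2 - (norm x)\<^sup>2"
    define \<rho> where "\<rho> = norm v + sqrt K"
    have "(y, r) \<in> cball 0 \<rho> \<times> {c - \<rho> * norm a .. M / b}" if q: "(y, r) \<in> S" for y r
    proof -
      have e: "\<theta> y \<le> ereal r" and hM: "b * r + 1 / 2 * (norm (x - y))\<^sup>2 \<le> M"
        using q unfolding S_def ereal_epigraph_def h_def by auto
      have r: "c + y \<bullet> a \<le> r"
        using minorant[OF in_epigraphD(1)[OF cpc e]] in_epigraphD(2)[OF cpc e] by linarith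
      \<comment> \<open>Completing the square turns the minorant of the objective into a ball around \<open>v\<close>.\<close>
      have square: "(norm (y - v))\<^sup>2
          = (norm (x - y))\<^sup>2 + 2 * b * (y \<bullet> a) + (norm v)\<^sup>2 - (norm x)\<^sup>2"
        unfolding v_def power2_norm_eq_inner
        by (simp add: inner_commute algebra_simps)
      have "b * (c + y \<bullet> a) \<le> b * r" using r b by simp
      then have "(norm (y - v))\<^sup>2 \<le> K"
        unfolding square K_def using hM by (simp add: algebra_simps)
      then have "norm (y - v) \<le> sqrt K" by (rule real_le_rsqrt)
      then have y: "norm y \<le> \<rho>"
        unfolding \<rho>_def using norm_triangle_ineq[of v "y - v"] by simp
      have "\<bar>y \<bullet> a\<bar> \<le> \<rho> * norm a"
        using Cauchy_Schwarz_ineq2[of y a] mult_right_mono[OF y, of "norm a"] by simp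
      then have "c - \<rho> * norm a \<le> r" using r by linarith
      moreover have "b * r \<le> M" using hM zero_le_power2[of "norm (x - y)"] by linarith
      then have "r \<le> M / b" using b by (simp add: field_simps)
      ultimately show ?thesis using y by simp
    qed
    then have "S \<subseteq> cball 0 \<rho> \<times> {c - \<rho> * norm a .. M / b}" by auto
    then show ?thesis by (rule bounded_subset[rotated]) (simp add: bounded_Times)
  qed
  ultimately have "compact S" by (simp add: compact_eq_bounded_closed)
  moreover have "S \<noteq> {}" using wE unfolding S_def M_def by auto
  moreover have "continuous_on S h" using h_cont continuous_on_subset by blast
  ultimately obtain m where mS: "m \<in> S" and m: "\<And>q. q \<in> S \<Longrightarrow> h m \<le> h q"
    using continuous_attains_inf[of S h] by metis
  obtain p s where ps: "m = (p, s)" by fastforce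
  have e: "\<theta> p \<le> ereal s" using mS unfolding S_def ereal_epigraph_def ps by auto
  note p = in_epigraphD[OF cpc e]
  have "ereal b * \<theta> p + ereal (1 / 2 * (norm (x - p))\<^sup>2)
          \<le> ereal b * \<theta> y + ereal (1 / 2 * (norm (x - y))\<^sup>2)" for y
  proof (cases "y \<in> effective_domain \<theta>")
    case True
    have "h m \<le> h (y, ?t y)"
    proof (cases "h (y, ?t y) \<le> M")
      case le: True
      then have "(y, ?t y) \<in> S"
        using ereal_value_on_domain[OF cpc True] unfolding S_def ereal_epigraph_def by auto
      then show ?thesis by (rule m)
    next
      case False
      then show ?thesis using mS unfolding S_def by auto
    qed
    moreover have "b * ?t p \<le> b * s" using p(2) b by simp
    ultimately have "b * ?t p + 1 / 2 * (norm (x - p))\<^sup>2 \<le> b * ?t y + 1 / 2 * (norm (x - y))\<^sup>2"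
      unfolding h_def ps by simp
    then show ?thesis
      by (subst ereal_value_on_domain[OF cpc p(1)], subst ereal_value_on_domain[OF cpc True]) simp
  next
    case False
    then have "\<theta> y = \<infinity>" unfolding effective_domain_def by simp
    then show ?thesis using b by simp
  qed
  then show ?thesis unfolding is_arg_min_def by (meson leD)
qed

text \<open>
  Compare the minimizer \<open>p\<close> with the points \<open>p + u (y - p)\<close> of a segment, bound \<open>\<theta>\<close> there by
  convexity, divide by \<open>u\<close> and let \<open>u\<close> tend to \<open>0\<close>.
\<close>

lemma prox_minimizer_variational:
  assumes cpc: "closed_proper_convex \<theta>" and b: "b > 0"
    and p: "is_arg_min (\<lambda>y. ereal b * \<theta> y + ereal (1 / 2 * (norm (x - y))\<^sup>2)) (\<lambda>_. True) p"
  shows "p \<in> effective_domain \<theta>"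
    and "y \<in> effective_domain \<theta> \<Longrightarrow>
      (x - p) \<bullet> (y - p) \<le> b * (real_of_ereal (\<theta> y) - real_of_ereal (\<theta> p))"
proof -
  let ?t = "\<lambda>y. real_of_ereal (\<theta> y)"
  have min: "ereal b * \<theta> p + ereal (1 / 2 * (norm (x - p))\<^sup>2)
          \<le> ereal b * \<theta> y + ereal (1 / 2 * (norm (x - y))\<^sup>2)" for y
    using p unfolding is_arg_min_def by (meson not_le_imp_less)
  show pd: "p \<in> effective_domain \<theta>"
  proof (rule ccontr)
    assume "p \<notin> effective_domain \<theta>"
    then have "\<theta> p = \<infinity>" unfolding effective_domain_def by simp
    moreover obtain w where "w \<in> effective_domain \<theta>"
      using cpc unfolding closed_proper_convex_def by blast
    then obtain r where "\<theta> w = ereal r" using ereal_value_on_domain[OF cpc] by blast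
    ultimately show False using min[of w] b by simp
  qed
  have min_real: "b * ?t p + 1 / 2 * (norm (x - p))\<^sup>2 \<le> b * ?t z + 1 / 2 * (norm (x - z))\<^sup>2"
    if z: "z \<in> effective_domain \<theta>" for z
  proof -
    obtain i j where "\<theta> p = ereal i" "\<theta> z = ereal j"
      using ereal_value_on_domain[OF cpc pd] ereal_value_on_domain[OF cpc z] by blast
    then show ?thesis using min[of z] by simp
  qed
  assume y: "y \<in> effective_domain \<theta>"
  define A where "A = (x - p) \<bullet> (y - p)"
  define B where "B = b * (?t y - ?t p)"
  define D where "D = 1 / 2 * (norm (y - p))\<^sup>2"
  have bound: "A \<le> B + u * D" if u: "0 < u" "u \<le> 1" for u
  proof -
    let ?z = "p + u *\<^sub>R (y - p)"
    note z = convex_on_domain[OF cpc pd y order.strict_implies_order[OF u(1)] u(2)]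
    have "b * ?t p + 1 / 2 * (norm (x - p))\<^sup>2 \<le> b * ?t ?z + 1 / 2 * (norm (x - ?z))\<^sup>2"
      by (rule min_real[OF z(1)])
    also have "b * ?t ?z \<le> b * (?t p + u * (?t y - ?t p))"
      using z(2) b by simp
    also have "(norm (x - ?z))\<^sup>2 = (norm ((x - p) - u *\<^sub>R (y - p)))\<^sup>2"
      by (simp add: algebra_simps)
    also have "\<dots> = (norm (x - p))\<^sup>2 - 2 * u * A + u\<^sup>2 * (norm (y - p))\<^sup>2"
      unfolding A_def power2_norm_eq_inner
      by (simp only: inner_diff_left inner_diff_right inner_scaleR_left inner_scaleR_right
            inner_commute[of p x] inner_commute[of y x] inner_commute[of y p])
        (simp add: algebra_simps power2_eq_square)
    finally have "u * A \<le> u * (B + u * D)"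
      unfolding B_def D_def by (simp add: algebra_simps power2_eq_square)
    then show ?thesis using u(1) by simp
  qed
  have "((\<lambda>u. B + u * D) \<longlongrightarrow> B + 0 * D) (at_right 0)"
    by (intro tendsto_intros)
  moreover have "\<forall>\<^sub>F u in at_right (0::real). A \<le> B + u * D"
    using eventually_at_right_real[of 0 "1::real", OF zero_less_one]
    by (rule eventually_mono) (auto intro: bound)
  ultimately have "A \<le> B + 0 * D"
    by (intro tendsto_lowerbound) auto
  then show "(x - p) \<bullet> (y - p) \<le> b * (?t y - ?t p)" unfolding A_def B_def by simp
qed

text \<open>
  The variational inequality also yields uniqueness of the minimizer, so that the definite
  description in \<^const>\<open>prox\<close> denotes it.
\<close>

lemma prox_variational:
  assumes cpc: "closed_proper_convex \<theta>" and b: "b > 0"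
    and minorant: "\<And>y. y \<in> effective_domain \<theta> \<Longrightarrow> c + y \<bullet> a \<le> real_of_ereal (\<theta> y)"
    and p: "p = prox (\<lambda>y. ereal b * \<theta> y) x"
  shows "p \<in> effective_domain \<theta>"
    and "y \<in> effective_domain \<theta> \<Longrightarrow>
      (x - p) \<bullet> (y - p) \<le> b * (real_of_ereal (\<theta> y) - real_of_ereal (\<theta> p))"
proof -
  let ?P = "is_arg_min (\<lambda>y. ereal b * \<theta> y + ereal (1 / 2 * (norm (x - y))\<^sup>2)) (\<lambda>_. True)"
  note vi = prox_minimizer_variational[OF cpc b, of x]
  have unique: "q = r" if q: "?P q" and r: "?P r" for q r
  proof -
    have "(x - q) \<bullet> (r - q) + (x - r) \<bullet> (q - r) \<le> 0"
      using vi(2)[OF q vi(1)[OF r]] vi(2)[OF r vi(1)[OF q]] by (simp add: algebra_simps)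
    also have "(x - q) \<bullet> (r - q) + (x - r) \<bullet> (q - r) = (r - q) \<bullet> (r - q)"
      by (simp add: inner_commute algebra_simps)
    finally have "(norm (r - q))\<^sup>2 \<le> 0" by (simp only: power2_norm_eq_inner)
    then show ?thesis by simp
  qed
  obtain q where "?P q" using prox_minimizer_exists[OF cpc b minorant, of x] by blast
  then have "?P p" unfolding p prox_def by (rule theI) (rule unique[OF _ \<open>?P q\<close>])
  then show "p \<in> effective_domain \<theta>"
    and "y \<in> effective_domain \<theta> \<Longrightarrow>
      (x - p) \<bullet> (y - p) \<le> b * (real_of_ereal (\<theta> y) - real_of_ereal (\<theta> p))"
    using vi by blast+
qed

section \<open>One step of the method\<close>

text \<open>
  Adding the predictor's inequality, the corrector's and \<open>b\<close> times the one for the solution, with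
  \<open>F s\<close> replaced by \<open>F y\<close> through monotonicity, cancels all values of \<open>t\<close>. The
  polarization identity turns the inner products into squared distances, and Young's inequality
  with the acceptance test absorbs the cross term \<open>2 b (F x - F y) \<bullet> (x' - y)\<close>.
\<close>

lemma extragradient_descent:
  fixes x y x' s :: "'a::real_inner" and t :: "'a \<Rightarrow> real"
  assumes b: "b > 0"
    and mono: "(F y - F s) \<bullet> (y - s) \<ge> 0"
    and solution: "t s \<le> t y + (y - s) \<bullet> F s"
    and predictor: "(x - b *\<^sub>R F x - y) \<bullet> (x' - y) \<le> b * (t x' - t y)"
    and corrector: "(x - b *\<^sub>R F y - x') \<bullet> (s - x') \<le> b * (t s - t x')"
    and accept: "b * norm (F x - F y) \<le> \<nu> * norm (x - y)"
  shows "(norm (x' - s))\<^sup>2 \<le> (norm (x - s))\<^sup>2 - (1 - \<nu>\<^sup>2) * (norm (x - y))\<^sup>2"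
proof -
  have "t s \<le> t y + (y - s) \<bullet> F y"
    using solution mono by (simp add: inner_commute algebra_simps)
  then have "b * t s \<le> b * (t y + (y - s) \<bullet> F y)" using b by simp
  then have "(x - b *\<^sub>R F x - y) \<bullet> (x' - y) + (x - b *\<^sub>R F y - x') \<bullet> (s - x')
      - b * ((y - s) \<bullet> F y) \<le> 0"
    using predictor corrector by (simp add: algebra_simps)
  also have "(x - b *\<^sub>R F x - y) \<bullet> (x' - y) + (x - b *\<^sub>R F y - x') \<bullet> (s - x')
      - b * ((y - s) \<bullet> F y)
    = (x - y) \<bullet> (x' - y) + (x - x') \<bullet> (s - x') - b * ((F x - F y) \<bullet> (x' - y))"
    by (simp add: inner_commute algebra_simps)
  finally have "2 * ((x - y) \<bullet> (x' - y)) + 2 * ((x - x') \<bullet> (s - x'))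
      \<le> 2 * (b * ((F x - F y) \<bullet> (x' - y)))"
    by linarith
  moreover have "2 * ((x - y) \<bullet> (x' - y)) + 2 * ((x - x') \<bullet> (s - x'))
      = (norm (x - y))\<^sup>2 + (norm (x' - y))\<^sup>2 + (norm (x' - s))\<^sup>2 - (norm (x - s))\<^sup>2"
    unfolding power2_norm_eq_inner by (simp add: inner_commute algebra_simps)
  moreover have "2 * (b * ((F x - F y) \<bullet> (x' - y)))
      \<le> \<nu>\<^sup>2 * (norm (x - y))\<^sup>2 + (norm (x' - y))\<^sup>2"
  proof -
    have "b * ((F x - F y) \<bullet> (x' - y)) \<le> b * (norm (F x - F y) * norm (x' - y))"
      using b norm_cauchy_schwarz by (intro mult_left_mono) auto
    also have "\<dots> \<le> (\<nu> * norm (x - y)) * norm (x' - y)"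
      using mult_right_mono[OF accept, of "norm (x' - y)"] by (simp add: mult.assoc)
    finally show ?thesis
      using sum_squares_bound[of "\<nu> * norm (x - y)" "norm (x' - y)"]
      by (simp add: power_mult_distrib)
  qed
  ultimately show ?thesis by (simp add: algebra_simps)
qed

section \<open>Passage to the limit\<close>

text \<open>
  Rearranged, the predictor's inequality says that \<open>(y\<^bsub>k\<^esub>, r\<^bsub>k\<^esub>)\<close> lies in the epigraph, where
  \<open>r\<^bsub>k\<^esub> = \<theta> w + (w - y\<^bsub>k\<^esub>) \<bullet> F x\<^bsub>k\<^esub> - (x\<^bsub>k\<^esub> - y\<^bsub>k\<^esub>) \<bullet> (w - y\<^bsub>k\<^esub>) / b\<^bsub>k\<^esub>\<close>. The quotient vanishes in the limit
  because \<open>b\<^bsub>k\<^esub>\<close> stays away from \<open>0\<close>, and the closed epigraph retains the limit point.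
\<close>

lemma predictor_limit_solves:
  assumes cpc: "closed_proper_convex \<theta>" and F: "continuous_on UNIV F"
    and lim_x: "x \<longlonglongrightarrow> z" and lim_y: "y \<longlonglongrightarrow> z"
    and m: "m > 0" and b: "\<And>k::nat. m \<le> b k"
    and dom: "\<And>k. y k \<in> effective_domain \<theta>"
    and vi: "\<And>k w. w \<in> effective_domain \<theta> \<Longrightarrow>
      (x k - b k *\<^sub>R F (x k) - y k) \<bullet> (w - y k)
        \<le> b k * (real_of_ereal (\<theta> w) - real_of_ereal (\<theta> (y k)))"
  shows "z \<in> mgvi_solutions \<theta> F"
proof -
  let ?t = "\<lambda>y. real_of_ereal (\<theta> y)"
  have lim_F: "(\<lambda>k. F (x k)) \<longlonglongrightarrow> F z"
    using F lim_x by (rule continuous_on_tendsto_compose) auto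
  have epi: "\<theta> z \<le> ereal (?t w + (w - z) \<bullet> F z)" if w: "w \<in> effective_domain \<theta>" for w
  proof -
    define q where "q k = (x k - y k) \<bullet> (w - y k) / b k" for k
    have "(\<lambda>k. norm ((x k - y k) \<bullet> (w - y k)) / m) \<longlonglongrightarrow> norm ((z - z) \<bullet> (w - z)) / m"
      using m by (intro tendsto_intros lim_x lim_y) auto
    then have lim_maj: "(\<lambda>k. norm ((x k - y k) \<bullet> (w - y k)) / m) \<longlonglongrightarrow> 0" by simp
    have "norm (q k) \<le> norm ((x k - y k) \<bullet> (w - y k)) / m" for k
      using m b[of k] unfolding q_def by (simp add: frac_le)
    then have lim_q: "q \<longlonglongrightarrow> 0"
      by (intro Lim_null_comparison[OF _ lim_maj]) auto
    define r where "r k = ?t w + (w - y k) \<bullet> F (x k) - q k" for k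
    have "(\<lambda>k. (y k, r k)) \<longlonglongrightarrow> (z, ?t w + (w - z) \<bullet> F z - 0)"
      unfolding r_def by (intro tendsto_intros lim_y lim_F lim_q)
    moreover have "(y k, r k) \<in> ereal_epigraph \<theta>" for k
    proof -
      have bk: "b k > 0" using m b[of k] by linarith
      have "(x k - y k) \<bullet> (w - y k) = b k * q k" using bk unfolding q_def by simp
      moreover have "(x k - y k) \<bullet> (w - y k) - b k * ((w - y k) \<bullet> F (x k))
          = (x k - b k *\<^sub>R F (x k) - y k) \<bullet> (w - y k)"
        by (simp add: inner_commute algebra_simps)
      ultimately have "b k * ?t (y k) \<le> b k * r k"
        using vi[OF w, of k] unfolding r_def by (simp add: algebra_simps)
      then have "?t (y k) \<le> r k" using bk by simp
      then show ?thesis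
        unfolding ereal_epigraph_def using ereal_value_on_domain[OF cpc dom[of k]]
        by (metis (mono_tags, lifting) case_prodI ereal_less_eq(3) mem_Collect_eq)
    qed
    moreover have "closed (ereal_epigraph \<theta>)"
      using cpc unfolding closed_proper_convex_def by blast
    ultimately have "(z, ?t w + (w - z) \<bullet> F z - 0) \<in> ereal_epigraph \<theta>"
      by (metis (no_types, lifting) closed_sequentially)
    then show ?thesis unfolding ereal_epigraph_def by simp
  qed
  show ?thesis
    unfolding mgvi_solutions_iff[OF cpc]
    using in_epigraphD[OF cpc epi] dom[of 0] by blast
qed

lemma Fejer_monotone_convergent:
  fixes x :: "nat \<Rightarrow> 'a::metric_space"
  assumes dec: "\<And>k. dist (x (Suc k)) z \<le> dist (x k) z"
    and sub: "strict_mono \<sigma>" "(x \<circ> \<sigma>) \<longlonglongrightarrow> z"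
  shows "x \<longlonglongrightarrow> z"
proof -
  have "decseq (\<lambda>k. dist (x k) z)" using dec by (intro decseq_SucI)
  then obtain l where l: "(\<lambda>k. dist (x k) z) \<longlonglongrightarrow> l"
    using decseq_convergent[of "\<lambda>k. dist (x k) z" 0] by auto
  have "(\<lambda>k. dist (x (\<sigma> k)) z) \<longlonglongrightarrow> l"
    using LIMSEQ_subseq_LIMSEQ[OF l sub(1)] by (simp add: o_def)
  moreover have "(\<lambda>k. dist (x (\<sigma> k)) z) \<longlonglongrightarrow> 0"
    using tendsto_dist_iff[THEN iffD1, OF sub(2)] by (simp add: o_def)
  ultimately have "l = 0" by (rule LIMSEQ_unique)
  then show ?thesis using l tendsto_dist_iff[THEN iffD2] by blast
qed

theorem theorem3p1:
  fixes \<theta> :: "real ^ 'n \<Rightarrow> ereal"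
    and F :: "real ^ 'n \<Rightarrow> real ^ 'n"
    and L \<nu> :: real
    and x0 :: "real ^ 'n"
    and \<beta> :: "nat \<Rightarrow> real"
    and x :: "nat \<Rightarrow> real ^ 'n"
  assumes "closed_proper_convex \<theta>"
    and "monotone_operator F"
    and "L > 0"
    and "lipschitz_on L UNIV F"
    and "mgvi_solutions \<theta> F \<noteq> {}"
    and "0 < \<nu>" and "\<nu> < 1"
    and "gem_sequence \<theta> F \<nu> x0 \<beta> x"
    and "bounded (range \<beta>)"
    and "(INF k. \<beta> k) > 0"
  shows "\<exists>xs \<in> mgvi_solutions \<theta> F. x \<longlonglongrightarrow> xs"
proof -
  note cpc = assms(1)
  let ?t = "\<lambda>y. real_of_ereal (\<theta> y)"
  obtain s where s: "s \<in> mgvi_solutions \<theta> F" using assms(5) by blast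
  have minorant: "(?t s + s \<bullet> F s) + y \<bullet> (- F s) \<le> ?t y" if "y \<in> effective_domain \<theta>" for y
    using s that unfolding mgvi_solutions_iff[OF cpc] by (auto simp: inner_diff_left)
  define y where "y k = gem_predictor \<theta> F (\<beta> k) (x k)" for k
  have \<beta>: "\<beta> k > 0"
    and accept: "\<beta> k * norm (F (x k) - F (y k)) \<le> \<nu> * norm (x k - y k)"
    and step: "x (Suc k) = prox (\<lambda>y. ereal (\<beta> k) * \<theta> y) (x k - \<beta> k *\<^sub>R F (y k))" for k
    using assms(8) unfolding gem_sequence_def y_def Let_def by blast+
  have predictor: "y k \<in> effective_domain \<theta>"
      "\<And>w. w \<in> effective_domain \<theta> \<Longrightarrow>
        (x k - \<beta> k *\<^sub>R F (x k) - y k) \<bullet> (w - y k) \<le> \<beta> k * (?t w - ?t (y k))" for k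
    using prox_variational[OF cpc \<beta>[of k] _ y_def[of k, unfolded gem_predictor_def]] minorant
    by blast+
  have corrector: "x (Suc k) \<in> effective_domain \<theta>"
      "\<And>w. w \<in> effective_domain \<theta> \<Longrightarrow>
        (x k - \<beta> k *\<^sub>R F (y k) - x (Suc k)) \<bullet> (w - x (Suc k))
          \<le> \<beta> k * (?t w - ?t (x (Suc k)))" for k
    using prox_variational[OF cpc \<beta>[of k] _ step[of k]] minorant by blast+
  have descent: "(norm (x (Suc k) - z))\<^sup>2
      \<le> (norm (x k - z))\<^sup>2 - (1 - \<nu>\<^sup>2) * (norm (x k - y k))\<^sup>2"
    if z: "z \<in> mgvi_solutions \<theta> F" for z k
  proof (rule extragradient_descent[where t = ?t and b = "\<beta> k" and F = F])
    have zd: "z \<in> effective_domain \<theta>"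
      and z_le: "\<And>w. w \<in> effective_domain \<theta> \<Longrightarrow> ?t z \<le> ?t w + (w - z) \<bullet> F z"
      using z unfolding mgvi_solutions_iff[OF cpc] by auto
    show "(F (y k) - F z) \<bullet> (y k - z) \<ge> 0"
      using assms(2) unfolding monotone_operator_def by blast
    show "?t z \<le> ?t (y k) + (y k - z) \<bullet> F z" by (rule z_le[OF predictor(1)])
    show "(x k - \<beta> k *\<^sub>R F (x k) - y k) \<bullet> (x (Suc k) - y k) \<le> \<beta> k * (?t (x (Suc k)) - ?t (y k))"
      by (rule predictor(2)[OF corrector(1)])
    show "(x k - \<beta> k *\<^sub>R F (y k) - x (Suc k)) \<bullet> (z - x (Suc k)) \<le> \<beta> k * (?t z - ?t (x (Suc k)))"
      by (rule corrector(2)[OF zd])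
  qed (rule \<beta> accept)+
  have gap: "1 - \<nu>\<^sup>2 > 0" using assms(6,7) by (simp add: power_less_one_iff)
  have Fejer: "dist (x (Suc k)) z \<le> dist (x k) z" if z: "z \<in> mgvi_solutions \<theta> F" for z k
  proof -
    have "(1 - \<nu>\<^sup>2) * (norm (x k - y k))\<^sup>2 \<ge> 0" using gap by simp
    then have "(norm (x (Suc k) - z))\<^sup>2 \<le> (norm (x k - z))\<^sup>2" using descent[OF z, of k] by linarith
    then show ?thesis by (simp add: dist_norm)
  qed
  have lim_gap: "(\<lambda>k. x k - y k) \<longlonglongrightarrow> 0"
  proof -
    define d where "d k = (norm (x k - s))\<^sup>2" for k
    have "decseq d"
      using Fejer[OF s] unfolding d_def by (intro decseq_SucI power_mono) (auto simp: dist_norm)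
    then obtain l where l: "d \<longlonglongrightarrow> l"
      using decseq_convergent[of d 0] unfolding d_def by auto
    have "(\<lambda>k. (d k - d (Suc k)) / (1 - \<nu>\<^sup>2)) \<longlonglongrightarrow> (l - l) / (1 - \<nu>\<^sup>2)"
      using gap l by (intro tendsto_intros LIMSEQ_Suc) auto
    then have "(\<lambda>k. (d k - d (Suc k)) / (1 - \<nu>\<^sup>2)) \<longlonglongrightarrow> 0" by simp
    moreover have "\<forall>k. norm ((norm (x k - y k))\<^sup>2) \<le> (d k - d (Suc k)) / (1 - \<nu>\<^sup>2)"
      using descent[OF s] gap unfolding d_def by (simp add: pos_le_divide_eq algebra_simps)
    ultimately have "(\<lambda>k. (norm (x k - y k))\<^sup>2) \<longlonglongrightarrow> 0"
      by (rule Lim_null_comparison[OF always_eventually, rotated])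
    then have "(\<lambda>k. sqrt ((norm (x k - y k))\<^sup>2)) \<longlonglongrightarrow> sqrt 0" by (rule tendsto_real_sqrt)
    then show ?thesis by (simp add: tendsto_norm_zero_iff)
  qed
  have "x k \<in> cball s (dist (x 0) s)" for k
    by (induction k) (use Fejer[OF s] in \<open>auto simp: dist_commute intro: order_trans\<close>)
  then obtain z \<sigma> where sub: "strict_mono \<sigma>" "(x \<circ> \<sigma>) \<longlonglongrightarrow> z"
    using compact_cball[of s "dist (x 0) s"] unfolding compact_def by meson
  have lim_x: "(\<lambda>k. x (\<sigma> k)) \<longlonglongrightarrow> z" using sub(2) by (simp add: o_def)
  have "(\<lambda>k. x (\<sigma> k) - y (\<sigma> k)) \<longlonglongrightarrow> 0"
    using LIMSEQ_subseq_LIMSEQ[OF lim_gap sub(1)] by (simp add: o_def)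
  from tendsto_diff[OF lim_x this] have lim_y: "(\<lambda>k. y (\<sigma> k)) \<longlonglongrightarrow> z" by simp
  have "bdd_below (range \<beta>)" using \<beta> by (intro bdd_belowI2[where m = 0]) (auto intro: less_imp_le)
  then have INF_le: "(INF k. \<beta> k) \<le> \<beta> j" for j by (rule cINF_lower) auto
  have "z \<in> mgvi_solutions \<theta> F"
    by (rule predictor_limit_solves[OF cpc lipschitz_on_continuous_on[OF assms(4)] lim_x lim_y
          assms(10) INF_le predictor])
  with Fejer sub show ?thesis by (meson Fejer_monotone_convergent)
qed

end
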